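(* For every $h \in \mathbb{N}$, the morphism $\varphi_h$ is irreducible and irreducible after the first position with respect to overlaps. Consequently $\varphi$ also has both these properties.
   Context: $\mathbb{N}=\{0,1,2,\ldots\}$ is an alphabet with its usual order; $x\cdot y$ denotes concatenation; $w[p]$ is the $p$th letter of $w$ (indexing from 1). An overlap is a word $cxcxc$ with $c$ a letter and $x$ a possibly empty word. A word $w$ is irreducible at position $p$ (with respect to overlaps) if replacing $w[p]$ by any strictly smaller letter of $\mathbb{N}$ produces a word having an overlap as a factor ending at position $p$ (in particular this holds automatically if $w[p]=0$; $w$ itself may already contain an overlap ending at $p$). A word is irreducible if it is irreducible at every position, and irreducible after the first position if it is irreducible at positions $2,\ldots,|w|$. A morphism is irreducible (resp. irreducible after the first position) if it maps every word with that property (in its domain) to a word with that property. $S$ is the left cyclic shift $S(cx)=xc$ and $S^{-1}$ its inverse, $S^{-1}(xc)=cx$. For each $h\in\mathbb{N}$ the morphism $\varphi_h \colon \{0,\ldots,h\}^* \to \{0,\ldots,h+1\}^*$ is defined recursively by $\varphi_h(h') = \varphi_{h'}(h')$ for $h'<h$ and $\varphi_h(h) = \big(S^{-1}(\varphi_{h-1}\circ\cdots\circ\varphi_0(00))\big)\cdot(h+1)$ (so $\varphi_0(0)=001$); $\varphi\colon\mathbb{N}^*\to\mathbb{N}^*$ is the common extension of all $\varphi_h$, i.e. $\varphi(h)=S^{-1}(\varphi^h(00))\cdot(h+1)$. *)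

theory Defs
  imports Main
begin

section \<open>Overlaps and irreducibility\<close>

text \<open>Words over the alphabet of natural numbers are lists; positions are counted from 1,
  so the letter at position \<open>p\<close> of \<open>w\<close> is \<open>w ! (p - 1)\<close>.\<close>

type_synonym word = "nat list"

definition is_overlap :: "word \<Rightarrow> bool" where
  "is_overlap z \<longleftrightarrow> (\<exists>c x. z = [c] @ x @ [c] @ x @ [c])"

definition overlap_ending_at :: "word \<Rightarrow> nat \<Rightarrow> bool" where
  "overlap_ending_at w p \<longleftrightarrow> (\<exists>u z v. w = u @ z @ v \<and> is_overlap z \<and> length (u @ z) = p)"

definition irreducible_at :: "word \<Rightarrow> nat \<Rightarrow> bool" where
  "irreducible_at w p \<longleftrightarrow> (\<forall>b < w ! (p - 1). overlap_ending_at (w[p - 1 := b]) p)"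

definition irreducible_word :: "word \<Rightarrow> bool" where
  "irreducible_word w \<longleftrightarrow> (\<forall>p \<in> {1..length w}. irreducible_at w p)"

definition irreducible_word_after_first :: "word \<Rightarrow> bool" where
  "irreducible_word_after_first w \<longleftrightarrow> (\<forall>p \<in> {2..length w}. irreducible_at w p)"


section \<open>Morphisms\<close>

text \<open>A morphism from words over \<open>A\<close> is given by the images \<open>f a\<close> of the letters \<open>a \<in> A\<close>;
  the values of \<open>f\<close> outside \<open>A\<close> are irrelevant.\<close>

definition morph :: "(nat \<Rightarrow> word) \<Rightarrow> word \<Rightarrow> word" where
  "morph f w = concat (map f w)"

lemma morph_cong [fundef_cong]:
  "v = w \<Longrightarrow> (\<And>c. c \<in> set w \<Longrightarrow> f c = g c) \<Longrightarrow> morph f v = morph g w"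
  by (auto simp: morph_def intro!: arg_cong[of _ _ concat])

definition irreducible_morphism :: "nat set \<Rightarrow> (nat \<Rightarrow> word) \<Rightarrow> bool" where
  "irreducible_morphism A f \<longleftrightarrow>
     (\<forall>w \<in> lists A. irreducible_word w \<longrightarrow> irreducible_word (morph f w))"

definition irreducible_morphism_after_first :: "nat set \<Rightarrow> (nat \<Rightarrow> word) \<Rightarrow> bool" where
  "irreducible_morphism_after_first A f \<longleftrightarrow>
     (\<forall>w \<in> lists A. irreducible_word_after_first w \<longrightarrow> irreducible_word_after_first (morph f w))"


section \<open>The morphisms \<open>\<phi>\<^sub>h\<close> and \<open>\<phi>\<close>\<close>

text \<open>The left cyclic shift is \<^const>\<open>rotate1\<close>; the following is its inverse.\<close>

definition unrotate1 :: "word \<Rightarrow> word" where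
  "unrotate1 w = (if w = [] then [] else last w # butlast w)"

lemma unrotate1_snoc: "unrotate1 (x @ [c]) = c # x"
  by (simp add: unrotate1_def)

lemma rotate1_unrotate1: "rotate1 (unrotate1 w) = w"
  by (simp add: unrotate1_def)

lemma unrotate1_rotate1: "unrotate1 (rotate1 w) = w"
  by (cases w) (simp_all add: unrotate1_def)

text \<open>\<open>phi_upto h k\<close> is the image of the letter \<open>k\<close> under \<open>\<phi>\<^sub>h\<close>. The fold is
  \<open>\<phi>\<^sub>h\<^sub>-\<^sub>1 \<circ> \<dots> \<circ> \<phi>\<^sub>0\<close>, with \<open>\<phi>\<^sub>0\<close> applied first. Letters \<open>k > h\<close> are outside
  the domain of \<open>\<phi>\<^sub>h\<close> and get a dummy value.\<close>

function phi_upto :: "nat \<Rightarrow> nat \<Rightarrow> word" where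
  "phi_upto h k =
     (if k < h then phi_upto k k
      else if k = h then
        unrotate1 (fold (\<lambda>i w. morph (\<lambda>c. phi_upto i c) w) [0..<h] [0, 0]) @ [h + 1]
      else [])"
  by pat_completeness auto
termination
  by (relation "measure fst") auto

declare phi_upto.simps [simp del]

text \<open>The common extension of all \<open>\<phi>\<^sub>h\<close>, on letters.\<close>

definition phi :: "nat \<Rightarrow> word" where
  "phi k = phi_upto k k"

lemma phi_upto_eq_phi: "k \<le> h \<Longrightarrow> phi_upto h k = phi k"
  by (cases "k = h") (simp_all add: phi_def phi_upto.simps[of h k])

lemma morph_phi_upto: "w \<in> lists {0..h} \<Longrightarrow> morph (phi_upto h) w = morph phi w"
  by (rule morph_cong) (auto simp: phi_upto_eq_phi)

lemma set_unrotate1: "set (unrotate1 w) = set w"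
  by (metis rotate1_unrotate1 set_rotate1)

lemma set_phi_upto: "set (phi_upto h k) \<subseteq> {0..h + 1}"
proof (induction h arbitrary: k rule: less_induct)
  case (less h)
  have "set (fold (\<lambda>i w. morph (phi_upto i) w) [0..<j] [0, 0]) \<subseteq> {0..j}" if "j \<le> h" for j
    using that
  proof (induction j)
    case (Suc j)
    then show ?case
      using less[of j] by (fastforce simp: morph_def)
  qed simp
  then have fold: "set (fold (\<lambda>i w. morph (phi_upto i) w) [0..<h] [0, 0]) \<subseteq> {0..h}"
    by blast
  consider "k < h" | "k = h" | "k > h"
    by linarith
  then show ?case
  proof cases
    case 1
    then have "set (phi_upto k k) \<subseteq> {0..h + 1}"
      using less[of k k] by fastforce
    with 1 show ?thesis
      by (simp add: phi_upto.simps[of h k])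
  next
    case 2
    with fold show ?thesis
      by (fastforce simp: phi_upto.simps[of h h] set_unrotate1)
  qed (simp add: phi_upto.simps[of h k])
qed

lemma fold_phi_upto:
  "fold (\<lambda>i w. morph (phi_upto i) w) [0..<h] [0, 0] = (morph phi ^^ h) [0, 0] \<and>
   (morph phi ^^ h) [0, 0] \<in> lists {0..h}"
proof (induction h)
  case (Suc h)
  have "morph (phi_upto h) w \<in> lists {0..Suc h}" for w
    using set_phi_upto[of h] by (fastforce simp: morph_def in_lists_conv_set)
  then have "morph phi ((morph phi ^^ h) [0, 0]) \<in> lists {0..Suc h}"
    using Suc morph_phi_upto[of "(morph phi ^^ h) [0, 0]" h] by metis
  with Suc morph_phi_upto[of "(morph phi ^^ h) [0, 0]" h] show ?case
    by simp
qed simp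

lemma phi_eq: "phi h = unrotate1 ((morph phi ^^ h) [0, 0]) @ [h + 1]"
  by (simp add: phi_def phi_upto.simps[of h h] fold_phi_upto)

lemma "phi 0 = [0, 0, 1]" "phi 1 = [1, 0, 0, 1, 0, 0, 2]"
  by (simp_all add: phi_eq morph_def unrotate1_def)

end

theory Submission
  imports Defs "HOL-Library.Sublist"
begin

text \<open>Since \<open>\<phi>\<^sup>h(0)\<close> ends with \<open>h\<close>, it has the form \<open>y\<^sub>h h\<close>, whence \<open>\<phi>(h) = h y\<^sub>h h y\<^sub>h (h+1)\<close>.
  Irreducibility of \<open>\<phi>(w)\<close> is checked inside each block \<open>\<phi>(a)\<close>, \<open>a = w[q]\<close>. At the first letter of
  the block it is inherited from \<open>w\<close>: an overlap \<open>b x b x b\<close> gives \<open>\<phi>(b) \<phi>(x) \<phi>(b) \<phi>(x) b\<close>, and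
  \<open>\<phi>(b)\<close> starts with \<open>b\<close>. The interior letters are letters of \<open>\<phi>\<^sup>a(00)\<close>, which is irreducible by
  induction. If the last letter is lowered to \<open>b \<le> a\<close>, the overlap \<open>b y\<^sub>b b y\<^sub>b b\<close> appears, because
  \<open>b y\<^sub>b b y\<^sub>b\<close> is a suffix of \<open>a y\<^sub>a a y\<^sub>a\<close>.\<close>

section \<open>Irreducibility expressed through prefixes\<close>

definition ends_in_overlap :: "word \<Rightarrow> bool" where
  "ends_in_overlap w \<longleftrightarrow> (\<exists>z. is_overlap z \<and> suffix z w)"

lemma ends_in_overlap_append: "ends_in_overlap w \<Longrightarrow> ends_in_overlap (u @ w)"
  by (auto simp: ends_in_overlap_def intro: suffix_appendI)

lemma ends_in_overlapI: "suffix (c # x @ c # x) u \<Longrightarrow> ends_in_overlap (u @ [c])"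
  unfolding ends_in_overlap_def is_overlap_def
  by (rule exI[of _ "(c # x @ c # x) @ [c]"]) auto

lemma ends_in_overlap_snocE:
  assumes "ends_in_overlap (u @ [c])"
  obtains v x where "u = v @ c # x @ c # x"
proof -
  obtain v d x where "u @ [c] = (v @ d # x @ d # x) @ [d]"
    using assms by (auto simp: ends_in_overlap_def is_overlap_def suffix_def)
  then show thesis
    using that by (metis append1_eq_conv)
qed

text \<open>The overlap has to end at the altered letter, so whatever follows that letter is
  irrelevant.\<close>

lemma irreducible_at_iff:
  "irreducible_at (u @ c # v) (Suc (length u)) \<longleftrightarrow> (\<forall>b<c. ends_in_overlap (u @ [b]))"
proof -
  have "overlap_ending_at (u @ b # v) (Suc (length u)) \<longleftrightarrow> ends_in_overlap (u @ [b])" for b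
  proof
    assume "overlap_ending_at (u @ b # v) (Suc (length u))"
    then obtain s z t where *: "(u @ [b]) @ v = (s @ z) @ t" "is_overlap z"
        "length (s @ z) = length (u @ [b])"
      by (auto simp: overlap_ending_at_def)
    then have "u @ [b] = s @ z"
      by (metis append_eq_append_conv)
    with * show "ends_in_overlap (u @ [b])"
      by (auto simp: ends_in_overlap_def suffix_def)
  next
    assume "ends_in_overlap (u @ [b])"
    then obtain s z where z: "u @ [b] = s @ z" "is_overlap z"
      by (auto simp: ends_in_overlap_def suffix_def)
    then have "u @ b # v = s @ z @ v"
      by (metis append.assoc append_Cons append_Nil)
    moreover have "length (s @ z) = Suc (length u)"
      by (metis z(1) length_append_singleton)
    ultimately show "overlap_ending_at (u @ b # v) (Suc (length u))"
      using z(2) unfolding overlap_ending_at_def by blast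
  qed
  then show ?thesis
    by (simp add: irreducible_at_def)
qed

lemma irreducible_word_after_first_iff:
  "irreducible_word_after_first w \<longleftrightarrow>
     (\<forall>u c v b. w = u @ c # v \<longrightarrow> u \<noteq> [] \<longrightarrow> b < c \<longrightarrow> ends_in_overlap (u @ [b]))"
proof
  assume *: "irreducible_word_after_first w"
  show "\<forall>u c v b. w = u @ c # v \<longrightarrow> u \<noteq> [] \<longrightarrow> b < c \<longrightarrow> ends_in_overlap (u @ [b])"
  proof (intro allI impI)
    fix u c v and b :: nat
    assume w: "w = u @ c # v" and "u \<noteq> []" "b < c"
    then have "Suc (length u) \<in> {2..length w}"
      by (cases u) auto
    with * have "irreducible_at w (Suc (length u))"
      by (simp add: irreducible_word_after_first_def)
    with \<open>b < c\<close> show "ends_in_overlap (u @ [b])"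
      by (simp add: w irreducible_at_iff)
  qed
next
  assume *: "\<forall>u c v b. w = u @ c # v \<longrightarrow> u \<noteq> [] \<longrightarrow> b < c \<longrightarrow> ends_in_overlap (u @ [b])"
  show "irreducible_word_after_first w"
    unfolding irreducible_word_after_first_def
  proof
    fix p assume p: "p \<in> {2..length w}"
    let ?u = "take (p - 1) w"
    have "p - 1 < length w" "Suc (p - 1) = p"
      using p by auto
    then have w: "w = ?u @ w ! (p - 1) # drop p w"
      using id_take_nth_drop[of "p - 1" w] by metis
    have "Suc (length ?u) = p" "?u \<noteq> []"
      using p by auto
    with * w show "irreducible_at w p"
      using irreducible_at_iff[of ?u "w ! (p - 1)" "drop p w"] by metis
  qed
qed

text \<open>An overlap has at least three letters, so no replacement at the first position can
  create one there; the first letter must be 0.\<close>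

lemma irreducible_word_iff:
  "irreducible_word w \<longleftrightarrow> irreducible_word_after_first w \<and> (w = [] \<or> hd w = 0)"
proof (cases w)
  case (Cons c v)
  have "\<not> ends_in_overlap [b]" for b
    by (auto simp: ends_in_overlap_def is_overlap_def suffix_def append_eq_Cons_conv)
  then have "irreducible_at w 1 \<longleftrightarrow> c = 0"
    using irreducible_at_iff[of "[]" c v] Cons by auto
  moreover have "{1..length w} = insert 1 {2..length w}"
    using Cons by auto
  ultimately show ?thesis
    using Cons by (simp add: irreducible_word_def irreducible_word_after_first_def conj_commute)
qed (simp add: irreducible_word_def irreducible_word_after_first_def)

section \<open>Positions inside a morphic image\<close>

lemma morph_simps [simp]:
  "morph f [] = []" "morph f (a # w) = f a @ morph f w"
  "morph f (u @ v) = morph f u @ morph f v"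
  by (simp_all add: morph_def)

lemma morph_eq_append_ConsE:
  assumes "morph f w = u @ c # v"
  obtains w1 a w2 s t where "w = w1 @ a # w2" "u = morph f w1 @ s" "f a = s @ c # t"
  using assms
proof (induction w arbitrary: u thesis)
  case (Cons a w)
  have "f a @ morph f w = u @ c # v"
    using Cons.prems(2) by simp
  then consider r where "u = f a @ r" "morph f w = r @ c # v" | t where "f a = u @ c # t"
    unfolding append_eq_append_conv2 by (metis append_Nil append_Nil2 append_eq_Cons_conv)
  then show ?case
  proof cases
    case 1
    obtain w1 a' w2 s t where "w = w1 @ a' # w2" "r = morph f w1 @ s" "f a' = s @ c # t"
      using Cons.IH[OF _ 1(2)] by metis
    with 1 show ?thesis
      using Cons.prems(1)[of "a # w1" a' w2 s t] by simp
  next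
    case 2
    then show ?thesis
      using Cons.prems(1)[of "[]" a w u t] by simp
  qed
qed simp

section \<open>The words y_h, written \<open>stem h\<close>\<close>

definition stem :: "nat \<Rightarrow> word" where
  "stem h = butlast ((morph phi ^^ h) [0])"

lemma morph_funpow_append: "(morph f ^^ h) (u @ v) = (morph f ^^ h) u @ (morph f ^^ h) v"
  by (induction h) simp_all

lemma funpow_phi_0: "(morph phi ^^ h) [0] = stem h @ [h]"
proof -
  have "\<exists>x. (morph phi ^^ h) [0] = x @ [h]"
  proof (induction h)
    case (Suc h)
    then obtain x where "(morph phi ^^ h) [0] = x @ [h]" ..
    then show ?case
      by (simp add: phi_eq[of h])
  qed simp
  then show ?thesis
    by (auto simp: stem_def)
qed

lemma funpow_phi_00: "(morph phi ^^ h) [0, 0] = stem h @ h # stem h @ [h]"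
  using morph_funpow_append[of h phi "[0]" "[0]"] by (simp add: funpow_phi_0)

lemma phi_eq_stem: "phi h = h # stem h @ h # stem h @ [Suc h]"
  using unrotate1_snoc[of "stem h @ h # stem h" h] by (simp add: phi_eq[of h] funpow_phi_00)

lemma stem_Suc: "stem (Suc h) = morph phi (stem h) @ h # stem h @ h # stem h"
proof -
  have "stem (Suc h) @ [Suc h] = morph phi (stem h @ [h])"
    by (simp flip: funpow_phi_0)
  also have "\<dots> = (morph phi (stem h) @ h # stem h @ h # stem h) @ [Suc h]"
    by (simp add: phi_eq_stem)
  finally show ?thesis
    by (metis append1_eq_conv)
qed

text \<open>By \<open>stem_Suc\<close>, y_(a+1) itself ends with a y_a a y_a, so the suffixes are
  nested along \<open>a\<close>.\<close>

lemma suffix_stem_double: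
  assumes "b \<le> a"
  shows "suffix (b # stem b @ b # stem b) (a # stem a @ a # stem a)"
  using assms
proof (induction rule: dec_induct)
  case (step a)
  have "suffix (a # stem a @ a # stem a) (stem (Suc a))"
    by (simp add: stem_Suc suffix_appendI)
  then have "suffix (a # stem a @ a # stem a) (Suc a # stem (Suc a) @ Suc a # stem (Suc a))"
    by (metis suffix_ConsI suffix_appendI)
  with step.IH show ?case
    by (rule suffix_order.trans)
qed simp

text \<open>The condition on the blocks is asked only for letters of \<open>w\<close>, so that the
  lemma can serve inside the induction that establishes this condition.\<close>

lemma irreducible_morph_phi_after_first:
  assumes "irreducible_word_after_first w"
    and "\<And>a. a \<in> set w \<Longrightarrow> irreducible_word_after_first (phi a)"
  shows "irreducible_word_after_first (morph phi w)"
  unfolding irreducible_word_after_first_iff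
proof (intro allI impI)
  fix u c v and b :: nat
  assume "morph phi w = u @ c # v" "u \<noteq> []" "b < c"
  then obtain w1 a w2 s t
    where w: "w = w1 @ a # w2" and u: "u = morph phi w1 @ s" and a: "phi a = s @ c # t"
    by (metis morph_eq_append_ConsE)
  show "ends_in_overlap (u @ [b])"
  proof (cases "s = []")
    case True
    with u a \<open>u \<noteq> []\<close> have "c = a" "w1 \<noteq> []"
      by (auto simp: phi_eq_stem)
    with assms(1) w \<open>b < c\<close> have "ends_in_overlap (w1 @ [b])"
      by (auto simp: irreducible_word_after_first_iff)
    then obtain v x where "w1 = v @ b # x @ b # x"
      by (rule ends_in_overlap_snocE)
    then have "suffix (phi b @ morph phi x @ phi b @ morph phi x) u"
      using u True by (simp add: suffix_appendI)
    \<comment> \<open>Since \<open>phi b\<close> starts with \<open>b\<close>, the word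
      \<open>phi b @ morph phi x\<close> is \<open>b\<close> followed by the witness below; its
      square is then closed by the lowered letter \<open>b\<close>.\<close>
    then show ?thesis
      using ends_in_overlapI[of b "stem b @ b # stem b @ Suc b # morph phi x" u]
      by (simp add: phi_eq_stem)
  next
    case False
    with assms(2)[of a] w a \<open>b < c\<close> have "ends_in_overlap (s @ [b])"
      by (auto simp: irreducible_word_after_first_iff)
    then show ?thesis
      by (simp add: u ends_in_overlap_append)
  qed
qed

text \<open>Each \<open>phi a\<close> starts with \<open>a\<close>, so a leading 0 survives.\<close>

lemma irreducible_morph_phi:
  assumes "irreducible_word w"
    and "\<And>a. a \<in> set w \<Longrightarrow> irreducible_word_after_first (phi a)"
  shows "irreducible_word (morph phi w)"
proof -
  have "morph phi w = [] \<or> hd (morph phi w) = 0"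
    using assms(1) by (cases w) (auto simp: irreducible_word_iff phi_eq_stem)
  with assms show ?thesis
    by (simp add: irreducible_word_iff irreducible_morph_phi_after_first)
qed

lemma irreducible_phi_after_first_if:
  assumes "irreducible_word ((morph phi ^^ a) [0, 0])"
  shows "irreducible_word_after_first (phi a)"
  unfolding irreducible_word_after_first_iff
proof (intro allI impI)
  fix u c v and b :: nat
  assume phi: "phi a = u @ c # v" and "u \<noteq> []" "b < c"
  show "ends_in_overlap (u @ [b])"
  proof (cases v rule: rev_cases)
    \<comment> \<open>The altered letter is the final \<open>Suc a\<close>, hence
      \<open>b \<le> a\<close>.\<close>
    case Nil
    with phi have "(a # stem a @ a # stem a) @ [Suc a] = u @ [c]"
      by (simp add: phi_eq_stem)
    then have "u = a # stem a @ a # stem a" "c = Suc a"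
      by (metis append1_eq_conv)+
    with \<open>b < c\<close> show ?thesis
      using suffix_stem_double[of b a] ends_in_overlapI[of b "stem b" u] by simp
  next
    case (snoc v' d)
    with phi have "(a # stem a @ a # stem a) @ [Suc a] = (u @ c # v') @ [d]"
      by (simp add: phi_eq_stem)
    then have "a # stem a @ a # stem a = u @ c # v'"
      by (metis append1_eq_conv)
    with \<open>u \<noteq> []\<close> obtain u' where u: "u = a # u'" "stem a @ a # stem a = u' @ c # v'"
      by (cases u) auto
    then have W: "(morph phi ^^ a) [0, 0] = u' @ c # v' @ [a]"
      using arg_cong[OF u(2), of "\<lambda>w. w @ [a]"] by (simp add: funpow_phi_00)
    \<comment> \<open>Otherwise \<open>c\<close> would be the first letter of an irreducible word,
      that is 0, leaving no smaller \<open>b\<close>.\<close>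
    with assms \<open>b < c\<close> have "u' \<noteq> []"
      by (auto simp: irreducible_word_iff)
    with assms W \<open>b < c\<close> have "ends_in_overlap (u' @ [b])"
      by (auto simp: irreducible_word_iff irreducible_word_after_first_iff)
    \<comment> \<open>Undoing the shift only puts \<open>a\<close> in front, which keeps the overlap
      at the end.\<close>
    then show ?thesis
      using ends_in_overlap_append[of _ "[a]"] by (simp add: u)
  qed
qed

text \<open>Strong induction is needed: the step to \<open>Suc k\<close> uses the blocks of all
  letters up to \<open>k\<close>, and the block of \<open>a\<close> depends on the
  \<open>a\<close>-th iterate.\<close>

lemma irreducible_funpow_phi_00: "irreducible_word ((morph phi ^^ h) [0, 0])"
proof (induction h rule: less_induct)
  case (less h)
  show ?case
  proof (cases h)
    case 0
    then show ?thesis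
      by (auto simp: irreducible_word_iff irreducible_word_after_first_iff
          append_eq_Cons_conv Cons_eq_append_conv)
  next
    case (Suc k)
    have "irreducible_word_after_first (phi a)" if "a \<in> set ((morph phi ^^ k) [0, 0])" for a
    proof (rule irreducible_phi_after_first_if)
      have "a \<le> k"
        using that fold_phi_upto[of k] by (auto simp: in_lists_conv_set)
      with Suc show "irreducible_word ((morph phi ^^ a) [0, 0])"
        by (simp add: less)
    qed
    with less[of k] Suc show ?thesis
      by (simp add: irreducible_morph_phi)
  qed
qed

lemma irreducible_phi_after_first: "irreducible_word_after_first (phi a)"
  by (rule irreducible_phi_after_first_if) (rule irreducible_funpow_phi_00)

text \<open>On words over \<open>{0..h}\<close> the maps induced by \<open>phi_upto h\<close> and
  \<open>phi\<close> agree, so every claim reduces to \<open>phi\<close>, all of whose blocks are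
  now known to be irreducible after the first position.\<close>

theorem theorem5:
  "(\<forall>h. irreducible_morphism {0..h} (phi_upto h) \<and>
        irreducible_morphism_after_first {0..h} (phi_upto h)) \<and>
   irreducible_morphism UNIV phi \<and>
   irreducible_morphism_after_first UNIV phi"
  by (simp add: irreducible_morphism_def irreducible_morphism_after_first_def morph_phi_upto
      irreducible_morph_phi irreducible_morph_phi_after_first irreducible_phi_after_first
      del: in_lists_conv_set)

end
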